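(* Let $\mathcal{G}$ be a connected simple weighted graph with $n$ nodes and $m$ edges, with incidence matrix $C$, positive diagonal matrices $M$ (inertias) and $B$ (susceptances), and damping matrix $D=\gamma M$ with $\gamma>0$. Let $L=M^{-1/2}CBC^TM^{-1/2}$ have eigenvalues $0=\lambda_1<\lambda_2\le\cdots\le\lambda_n$ with corresponding orthonormal eigenvectors $v_1,\dots,v_n$, and let $$A=\begin{bmatrix}-M^{-1}D & -M^{-1}C\\ BC^T & 0\end{bmatrix}\in\mathbb{R}^{(n+m)\times(n+m)}.$$ Then: 1. $0$ is an eigenvalue of $A$ of multiplicity $m-n+1$ (when $m-n+1=0$ this means that $0$ is not an eigenvalue of $A$), and the corresponding eigenvectors are of the form $[0;P]$ with $P\in\ker(C)$. 2. $-\gamma$ is a simple eigenvalue of $A$, with $[M^{-1/2}v_1;0]$ as a corresponding eigenvector. 3. For $i=2,3,\dots,n$, the numbers $\phi_{i,\pm}=\frac{-\gamma\pm\sqrt{\gamma^2-4\lambda_i}}{2}$ are eigenvalues of $A$ and, for any such $\phi_{i,\pm}$, an eigenvector is given by $[M^{-1/2}v_i;\ \phi_{i,\pm}^{-1}BC^TM^{-1/2}v_i]$.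
   Context: $\mathcal{G}=(\mathcal{N},\mathcal{E})$ with $\mathcal{N}=\{1,\dots,n\}$ is a connected simple graph with $|\mathcal{E}|=m$ edges, each given an arbitrary orientation. The incidence matrix $C\in\mathbb{R}^{n\times m}$ has $C_{je}=1$ if node $j$ is the source of $e$, $C_{je}=-1$ if $j$ is the target of $e$, and $0$ otherwise. $B$ is the $m\times m$ diagonal matrix of edge weights $B_{ij}>0$ (line susceptances); $M$ and $D$ are $n\times n$ diagonal matrices with entries $M_j>0$ and $D_j$, where the ratio $D_j/M_j=\gamma>0$ does not depend on $j$. $[a;b]$ denotes stacking $a$ on top of $b$ in a column. Eigenvalues and eigenvectors of $A$ are over $\mathbb{C}$, and square roots of negative numbers are purely imaginary. *)

theory Defs
  imports
    "HOL-Analysis.Analysis"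
    "Graph_Theory.Graph_Theory"
    "Jordan_Normal_Form.Jordan_Normal_Form_Uniqueness"
begin

text \<open>
  A finite simple graph together with an orientation of each of its edges is encoded as a
  digraph with one arc per edge: \<open>tail\<close> and \<open>head\<close> give the source and the target.  The
  undirected edge of an arc \<open>e\<close> is \<open>{tail G e, head G e}\<close>; injectivity excludes parallel
  as well as antiparallel arcs.
\<close>

definition oriented_simple_graph :: "('a, 'b) pre_digraph \<Rightarrow> bool" where
  "oriented_simple_graph G \<longleftrightarrow>
     digraph G \<and> inj_on (\<lambda>e. {tail G e, head G e}) (arcs G)"

definition incidence_mat :: "nat \<Rightarrow> nat \<Rightarrow> (nat, nat) pre_digraph \<Rightarrow> real mat" where
  "incidence_mat n m G =
     Matrix.mat n m (\<lambda>(j, e). if tail G e = j then 1 else if head G e = j then - 1 else 0)"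

text \<open>
  Real powers of a diagonal matrix with positive diagonal.  The lemmas below confirm that the
  exponents \<open>-1\<close> and \<open>-1/2\<close> give the inverse and its positive square root.
\<close>

definition diag_powr :: "real mat \<Rightarrow> real \<Rightarrow> real mat" where
  "diag_powr M a = mat_diag (dim_row M) (\<lambda>j. M $$ (j, j) powr a)"

lemma diag_powr_carrier [simp]: "M \<in> carrier_mat n n \<Longrightarrow> diag_powr M a \<in> carrier_mat n n"
  by (auto simp: diag_powr_def mat_diag_def)

lemma diag_powr_mult: "diag_powr M a * diag_powr M b = diag_powr M (a + b)"
  by (simp add: diag_powr_def powr_add)

lemma diag_powr_half_square:
  "diag_powr M (- 1 / 2) * diag_powr M (- 1 / 2) = diag_powr M (- 1)"
  by (simp add: diag_powr_mult)

lemma diag_powr_one: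
  assumes "M \<in> carrier_mat n n" "diagonal_mat M" "\<forall>j<n. 0 < M $$ (j, j)"
  shows "diag_powr M 1 = M"
  using assms by (intro eq_matI) (auto simp: diag_powr_def mat_diag_def diagonal_mat_def)

lemma diag_powr_zero:
  assumes "M \<in> carrier_mat n n" "\<forall>j<n. 0 < M $$ (j, j)"
  shows "diag_powr M 0 = 1\<^sub>m n"
  using assms by (intro eq_matI) (auto simp: diag_powr_def mat_diag_def)

lemma diag_powr_inverse:
  assumes "M \<in> carrier_mat n n" "diagonal_mat M" "\<forall>j<n. 0 < M $$ (j, j)"
  shows "M * diag_powr M (- 1) = 1\<^sub>m n" "diag_powr M (- 1) * M = 1\<^sub>m n"
  using diag_powr_mult[of M 1 "- 1"] diag_powr_mult[of M "- 1" 1] assms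
  by (simp_all add: diag_powr_one diag_powr_zero)

definition alg_multiplicity :: "'a::field mat \<Rightarrow> 'a \<Rightarrow> nat" where
  "alg_multiplicity A k = Polynomial.order k (char_poly A)"

definition geom_multiplicity :: "'a::field mat \<Rightarrow> 'a \<Rightarrow> nat" where
  "geom_multiplicity A k = kernel_dim (char_matrix A k)"

end

theory Submission
  imports Defs "Jordan_Normal_Form.Jordan_Normal_Form_Existence"
begin

text \<open>
  Write \<open>X = M\<^sup>-\<^sup>1 C\<close> and \<open>Y = B C\<^sup>T\<close>, so that \<open>A\<close> has the blocks \<open>-\<gamma> I\<close>, \<open>-X\<close>, \<open>Y\<close>, \<open>0\<close>.
  Eliminating the second block gives \<open>x\<^sup>n det (x I - A) = x\<^sup>m det (x (x + \<gamma>) I + X Y)\<close>.  The matrix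
  \<open>X Y\<close> is similar to \<open>L\<close>, hence the right-hand side is \<open>x\<^sup>m \<Prod>\<^sub>i (x\<^sup>2 + \<gamma> x + \<lambda>\<^sub>i)\<close>, and the algebraic
  multiplicities of \<open>0\<close> and \<open>-\<gamma>\<close> can be read off because only \<open>\<lambda>\<^sub>1\<close> vanishes.  The geometric
  multiplicity of \<open>0\<close> is the same since \<open>ker A\<^sup>2 = ker A\<close>: this follows from the fact that
  \<open>R W R\<^sup>T f = 0\<close> implies \<open>R\<^sup>T f = 0\<close> for a positive diagonal \<open>W\<close>.
\<close>

unbundle no inner_syntax and no vec_syntax

section \<open>Characteristic polynomials from orthonormal eigenvectors\<close>

lemma char_poly_mat_diag:
  "char_poly (mat_diag n f :: 'a::comm_ring_1 mat) = (\<Prod>i<n. [:- f i, 1:])"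
proof -
  have "char_poly (mat_diag n f) = (\<Prod>a\<leftarrow>diag_mat (mat_diag n f). [:- a, 1:])"
    by (rule char_poly_upper_triangular[where n = n]) (auto simp: mat_diag_def)
  also have "diag_mat (mat_diag n f) = map f [0..<n]"
    by (auto simp: diag_mat_def mat_diag_def)
  finally show ?thesis
    by (simp add: comp_def prod.list_conv_set_nth atLeast0LessThan)
qed

text \<open>The matrix \<open>V\<close> with columns \<open>v i\<close> is orthogonal, and
  \<open>S * V = V * mat_diag n l\<close> restates the eigenvector equations column by column. Hence
  \<open>V\<close> conjugates \<open>S\<close> to a diagonal matrix, whose characteristic polynomial
  is explicit.\<close>

lemma char_poly_orthonormal_eigenbasis:
  fixes S :: "'a::field mat" and v :: "nat \<Rightarrow> 'a vec"
  assumes S: "S \<in> carrier_mat n n"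
    and eig: "\<And>i. i < n \<Longrightarrow> eigenvector S (v i) (l i)"
    and ortho: "\<And>i j. i < n \<Longrightarrow> j < n \<Longrightarrow> v i \<bullet> v j = (if i = j then 1 else 0)"
  shows "char_poly S = (\<Prod>i<n. [:- l i, 1:])"
proof -
  define V where "V = Matrix.mat n n (\<lambda>(i, j). v j $ i)"
  have V: "V \<in> carrier_mat n n" by (simp add: V_def)
  have vc: "v i \<in> carrier_vec n" if "i < n" for i
    using eig[OF that] S by (auto simp: eigenvector_def)
  have col: "col V i = v i" if "i < n" for i
    using vc[OF that] that by (intro eq_vecI) (auto simp: V_def)
  have VV: "V\<^sup>T * V = 1\<^sub>m n"
    using V by (intro eq_matI) (auto simp: col ortho)
  \<comment> \<open>For square matrices a left inverse is also a right inverse.\<close>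
  have VV': "V * V\<^sup>T = 1\<^sub>m n"
    using mat_mult_left_right_inverse[OF _ V VV] V by auto
  have SV: "S * V = V * mat_diag n l"
  proof (rule eq_matI)
    fix i j assume "i < dim_row (V * mat_diag n l)" "j < dim_col (V * mat_diag n l)"
    then have ij: "i < n" "j < n" using V by (auto simp: mat_diag_def)
    have "(S * V) $$ (i, j) = (S *\<^sub>v v j) $ i"
      using ij S V by (simp add: col)
    also have "\<dots> = (l j \<cdot>\<^sub>v v j) $ i"
      using eig[OF ij(2)] by (simp add: eigenvector_def)
    also have "\<dots> = (V * mat_diag n l) $$ (i, j)"
      using ij vc[OF ij(2)] by (simp add: mat_diag_mult_right[OF V]) (simp add: V_def)
    finally show "(S * V) $$ (i, j) = (V * mat_diag n l) $$ (i, j)" .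
  qed (use S V in \<open>auto simp: mat_diag_def\<close>)
  have "S = S * (V * V\<^sup>T)" using S by (simp add: VV')
  also have "\<dots> = V * mat_diag n l * V\<^sup>T"
    using S V by (simp flip: SV add: assoc_mult_mat[of _ n n _ n _ n])
  finally have "similar_mat S (mat_diag n l)"
    using S V VV VV' by (intro similar_matI[of _ _ V "V\<^sup>T" n]) auto
  from char_poly_similar[OF this] show ?thesis
    by (simp add: char_poly_mat_diag)
qed

section \<open>Block elimination and eigenvectors of the block matrix\<close>

lemma det_shift_eq_char_poly:
  fixes N :: "'a::field mat"
  assumes N: "N \<in> carrier_mat n n"
  shows "det (y \<cdot>\<^sub>m 1\<^sub>m n + N) = (- 1) ^ n * poly (char_poly N) (- y)"
proof -
  \<comment> \<open>The characteristic polynomial is \<open>det (x I - N)\<close>; at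
    \<open>x = - y\<close> its argument is the negative of the matrix wanted, and pulling out
    \<open>- 1\<close> from \<open>n\<close> rows gives the sign.\<close>
  have "y \<cdot>\<^sub>m 1\<^sub>m n + N = - 1 \<cdot>\<^sub>m (- char_matrix N (- y))"
    using N by (intro eq_matI) (auto simp: char_matrix_def)
  then have "det (y \<cdot>\<^sub>m 1\<^sub>m n + N) = (- 1) ^ n * det (- char_matrix N (- y))"
    using N by (simp add: char_matrix_def)
  then show ?thesis by (simp add: char_poly_matrix[OF N])
qed

text \<open>The shape of \<open>A\<close> with \<open>X\<close> for the inverse of \<open>M\<close>
  times \<open>C\<close>, \<open>Y\<close> for \<open>B\<close> times the transpose of
  \<open>C\<close>, and \<open>g\<close> for the damping ratio. It is polymorphic so that it covers
  both the real matrix and its complexification.\<close>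

definition damped_mat :: "'a::comm_ring_1 \<Rightarrow> 'a mat \<Rightarrow> 'a mat \<Rightarrow> 'a mat" where
  "damped_mat g X Y =
     four_block_mat (- g \<cdot>\<^sub>m 1\<^sub>m (dim_row X)) (- X) Y (0\<^sub>m (dim_col X) (dim_col X))"

lemma damped_mat_carrier [simp]:
  "X \<in> carrier_mat n m \<Longrightarrow> damped_mat g X Y \<in> carrier_mat (n + m) (n + m)"
  by (auto simp: damped_mat_def)

lemma damped_mat_mult_append:
  assumes "X \<in> carrier_mat n m" "Y \<in> carrier_mat m n" "f \<in> carrier_vec n" "p \<in> carrier_vec m"
  shows "damped_mat g X Y *\<^sub>v (f @\<^sub>v p) = (- g \<cdot>\<^sub>v f - X *\<^sub>v p) @\<^sub>v (Y *\<^sub>v f)"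
proof -
  have "damped_mat g X Y *\<^sub>v (f @\<^sub>v p)
      = (- g \<cdot>\<^sub>m 1\<^sub>m n *\<^sub>v f + - X *\<^sub>v p) @\<^sub>v (Y *\<^sub>v f + 0\<^sub>m m m *\<^sub>v p)"
    unfolding damped_mat_def using assms
    by (subst four_block_mat_mult_vec[of _ n n _ m _ m]) auto
  also have "- g \<cdot>\<^sub>m 1\<^sub>m n *\<^sub>v f + - X *\<^sub>v p = - g \<cdot>\<^sub>v f - X *\<^sub>v p"
    using assms by (intro eq_vecI) auto
  also have "Y *\<^sub>v f + 0\<^sub>m m m *\<^sub>v p = Y *\<^sub>v f"
    using assms by auto
  finally show ?thesis .
qed

text \<open>
  Right multiplication of \<open>x I - A\<close> by the block matrix with rows \<open>[x I, 0]\<close> and \<open>[Y, I]\<close>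
  makes it block upper triangular, with the diagonal blocks \<open>x (x + g) I + X Y\<close> and \<open>x I\<close>.
\<close>
lemma char_poly_damped_mat:
  fixes X Y :: "'a::field mat"
  assumes X: "X \<in> carrier_mat n m" and Y: "Y \<in> carrier_mat m n"
  shows "x ^ n * poly (char_poly (damped_mat g X Y)) x
       = x ^ m * det ((x * (x + g)) \<cdot>\<^sub>m 1\<^sub>m n + X * Y)"
proof -
  let ?K = "- char_matrix (damped_mat g X Y) x"
  let ?T = "four_block_mat (x \<cdot>\<^sub>m 1\<^sub>m n) (0\<^sub>m n m) Y (1\<^sub>m m)"
  have K: "?K = four_block_mat ((x + g) \<cdot>\<^sub>m 1\<^sub>m n) X (- Y) (x \<cdot>\<^sub>m 1\<^sub>m m)"
    using X Y by (intro eq_matI) (auto simp: char_matrix_def damped_mat_def)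
  have "?K * ?T = four_block_mat (((x + g) \<cdot>\<^sub>m 1\<^sub>m n) * (x \<cdot>\<^sub>m 1\<^sub>m n) + X * Y)
      (((x + g) \<cdot>\<^sub>m 1\<^sub>m n) * 0\<^sub>m n m + X * 1\<^sub>m m)
      (- Y * (x \<cdot>\<^sub>m 1\<^sub>m n) + (x \<cdot>\<^sub>m 1\<^sub>m m) * Y) (- Y * 0\<^sub>m n m + (x \<cdot>\<^sub>m 1\<^sub>m m) * 1\<^sub>m m)"
    unfolding K using X Y by (intro mult_four_block_mat[of _ n n _ m _ m]) auto
  also have "((x + g) \<cdot>\<^sub>m 1\<^sub>m n) * (x \<cdot>\<^sub>m 1\<^sub>m n) = (x * (x + g)) \<cdot>\<^sub>m 1\<^sub>m n"
    by (intro eq_matI) auto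
  also have "((x + g) \<cdot>\<^sub>m 1\<^sub>m n) * 0\<^sub>m n m + X * 1\<^sub>m m = X"
    using X by simp
  also have "- Y * (x \<cdot>\<^sub>m 1\<^sub>m n) + (x \<cdot>\<^sub>m 1\<^sub>m m) * Y = 0\<^sub>m m n"
    using Y by (subst mult_smult_distrib[of _ m n], auto)
  also have "- Y * 0\<^sub>m n m + (x \<cdot>\<^sub>m 1\<^sub>m m) * 1\<^sub>m m = x \<cdot>\<^sub>m 1\<^sub>m m"
    using Y by simp
  finally have KT: "?K * ?T = four_block_mat ((x * (x + g)) \<cdot>\<^sub>m 1\<^sub>m n + X * Y) X
      (0\<^sub>m m n) (x \<cdot>\<^sub>m 1\<^sub>m m)" .
  have "det ?T = x ^ n"
    using Y by (simp add: det_four_block_mat_upper_right_zero[of _ n _ m])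
  then have "x ^ n * poly (char_poly (damped_mat g X Y)) x = det ?T * det ?K"
    by (simp only: char_poly_matrix[OF damped_mat_carrier[OF X]])
  also have "\<dots> = det (?K * ?T)"
    using X Y by (subst det_mult[of _ "n + m"]) (auto simp: K)
  also have "\<dots> = x ^ m * det ((x * (x + g)) \<cdot>\<^sub>m 1\<^sub>m n + X * Y)"
    unfolding KT using X Y by (subst det_four_block_mat_lower_left_zero[of _ n _ m]) auto
  finally show ?thesis .
qed

lemma zero_vec_append: "0\<^sub>v n @\<^sub>v 0\<^sub>v m = 0\<^sub>v (n + m)"
  by (intro eq_vecI) auto

lemma mult_mat_zero_vec: "K \<in> carrier_mat r c \<Longrightarrow> K *\<^sub>v 0\<^sub>v c = (0\<^sub>v r :: 'a::semiring_0 vec)"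
  by (intro eq_vecI) auto

text \<open>The second block row of the eigenvalue equation forces the lower component to be
  \<open>Y *\<^sub>v f\<close> divided by \<open>x\<close>. Substituting it into the first row
  leaves the scalar equation \<open>- g - inverse x * \<mu> = x\<close>, which is the quadratic
  relation between \<open>x\<close> and \<open>\<mu>\<close>.\<close>

lemma damped_mat_eigenvector:
  fixes X Y :: "'a::field mat"
  assumes X: "X \<in> carrier_mat n m" and Y: "Y \<in> carrier_mat m n"
    and f: "f \<in> carrier_vec n" "f \<noteq> 0\<^sub>v n"
    and XY: "X *\<^sub>v (Y *\<^sub>v f) = \<mu> \<cdot>\<^sub>v f"
    and x: "x * (x + g) = - \<mu>" "x \<noteq> 0"
  shows "eigenvector (damped_mat g X Y) (f @\<^sub>v (inverse x \<cdot>\<^sub>v (Y *\<^sub>v f))) x"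
proof -
  have Yf: "Y *\<^sub>v f \<in> carrier_vec m" using Y f by simp
  have "- g - inverse x * \<mu> = x"
  proof -
    have "\<mu> = - (x * (x + g))" using x by simp
    then have "inverse x * \<mu> = - (x + g)"
      using x(2) by (simp add: mult.assoc[symmetric] del: minus_add_distrib distrib_left)
    then show ?thesis by simp
  qed
  then have eq: "- g * c - inverse x * (\<mu> * c) = x * c" for c
    by (simp only: left_diff_distrib[symmetric] mult.assoc[symmetric])
  have "- g \<cdot>\<^sub>v f - X *\<^sub>v (inverse x \<cdot>\<^sub>v (Y *\<^sub>v f)) = x \<cdot>\<^sub>v f"
    using f eq by (subst mult_mat_vec[OF X Yf]) (auto simp: XY)
  moreover have "Y *\<^sub>v f = x \<cdot>\<^sub>v (inverse x \<cdot>\<^sub>v (Y *\<^sub>v f))"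
    using x by (simp add: smult_smult_assoc)
  ultimately have "damped_mat g X Y *\<^sub>v (f @\<^sub>v (inverse x \<cdot>\<^sub>v (Y *\<^sub>v f)))
      = (x \<cdot>\<^sub>v f) @\<^sub>v (x \<cdot>\<^sub>v (inverse x \<cdot>\<^sub>v (Y *\<^sub>v f)))"
    using X Y f Yf by (subst damped_mat_mult_append) auto
  also have "\<dots> = x \<cdot>\<^sub>v (f @\<^sub>v (inverse x \<cdot>\<^sub>v (Y *\<^sub>v f)))"
    by (intro eq_vecI) auto
  moreover have "f @\<^sub>v (inverse x \<cdot>\<^sub>v (Y *\<^sub>v f)) \<noteq> 0\<^sub>v (n + m)"
    using f by (metis append_vec_eq zero_carrier_vec zero_vec_append)
  ultimately show ?thesis
    using X Y f Yf by (simp add: eigenvector_def damped_mat_def)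
qed

text \<open>With lower component zero, no flow acts back on the nodes, and
  \<open>Y *\<^sub>v f = 0\<^sub>v m\<close> means that none builds up: only the block
  \<open>- g I\<close> acts.\<close>

lemma damped_mat_eigenvector_decay:
  fixes X Y :: "'a::field mat"
  assumes X: "X \<in> carrier_mat n m" and Y: "Y \<in> carrier_mat m n"
    and f: "f \<in> carrier_vec n" "f \<noteq> 0\<^sub>v n" and Yf: "Y *\<^sub>v f = 0\<^sub>v m"
  shows "eigenvector (damped_mat g X Y) (f @\<^sub>v 0\<^sub>v m) (- g)"
proof -
  have "- g \<cdot>\<^sub>v f - X *\<^sub>v 0\<^sub>v m = - g \<cdot>\<^sub>v f"
    using f X by (intro eq_vecI) auto
  then have "damped_mat g X Y *\<^sub>v (f @\<^sub>v 0\<^sub>v m) = - g \<cdot>\<^sub>v (f @\<^sub>v 0\<^sub>v m)"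
    using f by (subst damped_mat_mult_append[OF X Y f(1)]) (auto simp: Yf intro!: eq_vecI)
  moreover have "f @\<^sub>v 0\<^sub>v m \<noteq> 0\<^sub>v (n + m)"
    using f by (metis append_vec_eq zero_carrier_vec zero_vec_append)
  ultimately show ?thesis
    using X f by (simp add: eigenvector_def damped_mat_def)
qed

section \<open>Semisimple eigenvalues and kernels of weighted Gram matrices\<close>

lemma mat_kernel_eq_kernel_dim_eq:
  assumes "mat_kernel A = mat_kernel B" "dim_col A = dim_col B"
  shows "kernel_dim A = kernel_dim B"
  using assms by (simp add: kernel_dim_def)

text \<open>If squaring \<open>A - k I\<close> does not enlarge its kernel, every Jordan block for
  \<open>k\<close> has size 1. The number of these blocks is the geometric multiplicity, and the sum
  of their sizes is the algebraic one.\<close>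

lemma geom_eq_alg_multiplicity:
  fixes A :: "complex mat"
  assumes A: "A \<in> carrier_mat n n"
    and ker: "\<And>v. v \<in> carrier_vec n \<Longrightarrow>
      char_matrix A k *\<^sub>v (char_matrix A k *\<^sub>v v) = 0\<^sub>v n \<Longrightarrow> char_matrix A k *\<^sub>v v = 0\<^sub>v n"
  shows "geom_multiplicity A k = alg_multiplicity A k"
proof -
  let ?K = "char_matrix A k"
  have K: "?K \<in> carrier_mat n n" using A by simp
  obtain as where "char_poly A = (\<Prod>a\<leftarrow>as. [:- a, 1:])"
    using char_poly_factorized[OF A] by blast
  then obtain ns where jnf: "jordan_nf A ns"
    using jordan_nf_exists[OF A] by blast
  define sizes where "sizes = map fst (filter (\<lambda>(n, e). e = k) ns)"
  have pos: "0 \<notin> set sizes"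
    using jnf unfolding jordan_nf_def sizes_def by auto
  have "mat_kernel (?K ^\<^sub>m 2) = mat_kernel (?K ^\<^sub>m 1)"
  proof -
    have "?K ^\<^sub>m 2 = ?K * ?K" "?K ^\<^sub>m 1 = ?K"
      using K by (simp_all add: numeral_2_eq_2)
    moreover have "?K *\<^sub>v 0\<^sub>v n = 0\<^sub>v n"
      using K by (intro eq_vecI) auto
    then have "(?K * ?K) *\<^sub>v v = 0\<^sub>v n \<longleftrightarrow> ?K *\<^sub>v v = 0\<^sub>v n" if "v \<in> carrier_vec n" for v
      using ker[OF that] assoc_mult_mat_vec[OF K K that] by auto
    ultimately show ?thesis
      using K by (auto simp: mat_kernel[OF K] mat_kernel[OF mult_carrier_mat[OF K K]])
  qed
  then have "dim_gen_eigenspace A k 2 = dim_gen_eigenspace A k 1"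
    unfolding dim_gen_eigenspace_def using K by (intro mat_kernel_eq_kernel_dim_eq) auto
  \<comment> \<open>A block of size \<open>s\<close> for \<open>k\<close> contributes
    \<open>min j s\<close> to the dimension of the kernel of the \<open>j\<close>-th power of
    \<open>A - k I\<close>.\<close>
  then have min: "(\<Sum>s\<leftarrow>sizes. min 2 s) = (\<Sum>s\<leftarrow>sizes. min 1 s)"
    by (simp add: dim_gen_eigenspace[OF jnf] sizes_def)
  have step: "sum_list (map (min 1) ss) \<le> sum_list (map (min 2) ss)" for ss :: "nat list"
    by (intro sum_list_mono) auto
  \<comment> \<open>Each term of the sum for 2 is at least the corresponding term for 1, and
    strictly larger for a block of size at least 2. Equality of the sums thus leaves only sizes
    equal to 1.\<close>
  from min pos have "(\<Sum>s\<leftarrow>sizes. min 1 s) = sum_list sizes"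
  proof (induction sizes)
    case (Cons s ss)
    have "s = 1 \<or> 2 \<le> s" using Cons.prems(2) by auto
    then show ?case
    proof
      assume "s = 1"
      with Cons show ?thesis by simp
    next
      assume "2 \<le> s"
      then have "min 2 s = 2" "min 1 s = 1" by auto
      with Cons.prems(1) step[of ss] show ?thesis by simp
    qed
  qed simp
  moreover have "geom_multiplicity A k = (\<Sum>s\<leftarrow>sizes. min 1 s)"
    using K dim_gen_eigenspace[OF jnf, of k 1]
    by (simp add: dim_gen_eigenspace_def geom_multiplicity_def sizes_def)
  moreover have "alg_multiplicity A k = sum_list sizes"
    using jordan_nf_order[OF jnf, of k]
    by (simp add: alg_multiplicity_def sizes_def case_prod_beta')
  ultimately show ?thesis by simp
qed

text \<open>Pairing with the conjugate of \<open>f\<close> gives \<open>\<Sum>e. w e * \<bar>(R\<^sup>T f) e\<bar>\<^sup>2 = 0\<close>.\<close>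
lemma weighted_gram_kernel:
  fixes R :: "real mat" and f :: "complex vec"
  defines "Rc \<equiv> map_mat complex_of_real R"
  assumes R: "R \<in> carrier_mat r k" and f: "f \<in> carrier_vec r"
    and w: "\<And>e. e < k \<Longrightarrow> 0 < w e"
    and 0: "Rc *\<^sub>v (mat_diag k (\<lambda>e. complex_of_real (w e)) *\<^sub>v (Rc\<^sup>T *\<^sub>v f)) = 0\<^sub>v r"
  shows "Rc\<^sup>T *\<^sub>v f = 0\<^sub>v k"
proof -
  let ?W = "mat_diag k (\<lambda>e. complex_of_real (w e))"
  define g where "g = Rc\<^sup>T *\<^sub>v f"
  have Rc: "Rc \<in> carrier_mat r k" using R by (simp add: Rc_def)
  have g: "g \<in> carrier_vec k" using Rc f by (simp add: g_def)
  have Wg: "(?W *\<^sub>v g) $ e = w e * g $ e" if "e < k" for e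
  proof -
    have "(?W *\<^sub>v g) $ e = (\<Sum>j<k. (if e = j then of_real (w j) else 0) * g $ j)"
      using that g by (simp add: mat_diag_def scalar_prod_def atLeast0LessThan)
    also have "\<dots> = (\<Sum>j<k. if e = j then w j * g $ j else 0)"
      by (intro sum.cong) auto
    finally show ?thesis using that by simp
  qed
  \<comment> \<open>The entries of \<open>Rc\<close> are real, so conjugation passes through it.
    This matters because the scalar product used here is bilinear, not Hermitian.\<close>
  have "Rc\<^sup>T *\<^sub>v conjugate f = conjugate g"
    using Rc f R by (intro eq_vecI) (auto simp: g_def Rc_def scalar_prod_def)
  then have "conjugate g \<bullet> (?W *\<^sub>v g) = conjugate f \<bullet> (Rc *\<^sub>v (?W *\<^sub>v g))"
    using transpose_vec_mult_scalar[OF Rc, of "?W *\<^sub>v g" "conjugate f"] f g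
    by (simp add: mult_mat_vec_carrier[of _ k k])
  also have "\<dots> = 0"
    using 0 f by (simp add: g_def)
  also have "conjugate g \<bullet> (?W *\<^sub>v g) = (\<Sum>e<k. conjugate g $ e * (?W *\<^sub>v g) $ e)"
    unfolding scalar_prod_def by (simp add: mat_diag_def atLeast0LessThan)
  also have "\<dots> = (\<Sum>e<k. cnj (g $ e) * (w e * g $ e))"
    using g by (intro sum.cong refl) (simp add: Wg del: index_mult_mat_vec)
  also have "\<dots> = complex_of_real (\<Sum>e<k. w e * (cmod (g $ e))\<^sup>2)"
    unfolding of_real_sum of_real_mult complex_norm_square
    by (intro sum.cong refl) (simp only: mult_ac)
  finally have "(\<Sum>e<k. w e * (cmod (g $ e))\<^sup>2) = 0"
    by (simp only: of_real_eq_0_iff)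
  then have "\<forall>e<k. w e * (cmod (g $ e))\<^sup>2 = 0"
    by (subst (asm) sum_nonneg_eq_0_iff) (auto simp: w less_imp_le)
  then have "g $ e = 0" if "e < k" for e
    using that w[OF that] by auto
  then show ?thesis
    using g by (intro eq_vecI) (auto simp: g_def[symmetric])
qed

section \<open>Characteristic polynomial and multiplicities of the block matrix\<close>

lemma map_damped_mat:
  assumes "X \<in> carrier_mat n m" "Y \<in> carrier_mat m n"
  shows "map_mat complex_of_real (damped_mat g X Y)
       = damped_mat (of_real g) (map_mat of_real X) (map_mat of_real Y)"
  using assms by (intro eq_matI) (auto simp: damped_mat_def)

text \<open>The power of the variable stays on the left because \<open>m\<close> may be smaller than
  \<open>n\<close>, as for a tree. The two polynomials agree at every point, which suffices over an
  infinite field.\<close>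

lemma char_poly_damped_mat_prod:
  fixes X Y :: "'a::field_char_0 mat"
  assumes X: "X \<in> carrier_mat n m" and Y: "Y \<in> carrier_mat m n"
    and l: "char_poly (X * Y) = (\<Prod>i<n. [:- l i, 1:])"
  shows "monom 1 n * char_poly (damped_mat g X Y) = monom 1 m * (\<Prod>i<n. [:l i, g, 1:])"
proof -
  have "poly (monom 1 n * char_poly (damped_mat g X Y)) x
      = poly (monom 1 m * (\<Prod>i<n. [:l i, g, 1:])) x" for x
  proof -
    let ?y = "x * (x + g)"
    have XY: "X * Y \<in> carrier_mat n n" using X Y by simp
    have "det (?y \<cdot>\<^sub>m 1\<^sub>m n + X * Y) = (- 1) ^ n * (\<Prod>i<n. - ?y - l i)"
      by (simp add: det_shift_eq_char_poly[OF XY] l poly_prod minus_diff_commute)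
    \<comment> \<open>The sign is spread over the \<open>n\<close> factors, turning each into
      \<open>x * (x + g) + l i\<close>.\<close>
    also have "\<dots> = (\<Prod>i<n. - 1 * (- ?y - l i))"
      by (simp only: prod.distrib prod_constant card_lessThan)
    also have "\<dots> = (\<Prod>i<n. poly [:l i, g, 1:] x)"
      by (intro prod.cong refl) (simp add: algebra_simps)
    finally show ?thesis
      using char_poly_damped_mat[OF X Y, of x g] by (simp add: poly_monom poly_prod)
  qed
  then show ?thesis by (intro poly_eq_poly_eq_iff[THEN iffD1] ext)
qed

text \<open>The factor of index 0 splits as \<open>x * (x + g)\<close>, and the remaining factors
  vanish neither at \<open>0\<close> nor at \<open>- g\<close>. Comparing root orders on both sides
  of the product formula gives the multiplicities; the additive form avoids truncated
  subtraction.\<close>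

lemma alg_multiplicity_damped_mat:
  fixes X Y :: "'a::field_char_0 mat"
  assumes X: "X \<in> carrier_mat n m" and Y: "Y \<in> carrier_mat m n"
    and l: "char_poly (X * Y) = (\<Prod>i<n. [:- l i, 1:])"
    and n: "0 < n" and l0: "l 0 = 0" and l_pos: "\<And>i. 0 < i \<Longrightarrow> i < n \<Longrightarrow> l i \<noteq> 0"
    and g: "g \<noteq> 0"
  shows "n + alg_multiplicity (damped_mat g X Y) 0 = m + 1"
    and "alg_multiplicity (damped_mat g X Y) (- g) = 1"
proof -
  define p where "p = char_poly (damped_mat g X Y)"
  define q where "q = (\<Prod>i\<in>{1..<n}. [:l i, g, 1:])"
  have "{..<n} = insert 0 {1..<n}" using n by auto
  then have "(\<Prod>i<n. [:l i, g, 1:]) = [:0, 1:] * [:g, 1:] * q"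
    by (simp add: q_def l0)
  with char_poly_damped_mat_prod[OF X Y l, of g]
  have eq: "monom 1 n * p = monom 1 m * ([:0, 1:] * [:g, 1:] * q)"
    by (simp add: p_def)
  \<comment> \<open>At both points \<open>x * (x + g)\<close> is zero, so each factor takes the
    value \<open>l i\<close>.\<close>
  have q: "poly q 0 \<noteq> 0" "poly q (- g) \<noteq> 0"
    using l_pos by (auto simp: q_def poly_prod)
  then have "q \<noteq> 0" by auto
  then have nz: "monom 1 m * ([:0, 1:] * [:g, 1:] * q) \<noteq> 0" "[:0, 1:] * [:g, 1:] * q \<noteq> 0"
    "[:0, 1:] * [:g, 1:] \<noteq> (0 :: 'a poly)"
  proof -
    have "[:0, 1:] \<noteq> (0 :: 'a poly)" "[:g, 1:] \<noteq> 0" "monom 1 m \<noteq> (0 :: 'a poly)" by simp_all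
    with \<open>q \<noteq> 0\<close> show "monom 1 m * ([:0, 1:] * [:g, 1:] * q) \<noteq> 0"
      "[:0, 1:] * [:g, 1:] * q \<noteq> 0" "[:0, 1:] * [:g, 1:] \<noteq> (0 :: 'a poly)"
      by (simp_all only: mult_eq_0_iff simp_thms)
  qed
  with eq have nz': "monom 1 n * p \<noteq> 0" by simp
  have order_eq: "Polynomial.order x (monom 1 n) + Polynomial.order x p
      = Polynomial.order x (monom 1 m) + (Polynomial.order x [:0, 1:]
        + Polynomial.order x [:g, 1:] + Polynomial.order x q)" for x
    using arg_cong[OF eq, of "Polynomial.order x"]
    by (simp only: order_mult[OF nz'] order_mult[OF nz(1)] order_mult[OF nz(2)] order_mult[OF nz(3)])
  have "Polynomial.order 0 [:0, 1 :: 'a:] = 1" "Polynomial.order (- g) [:g, 1:] = 1"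
    using order_power_n_n[of "0 :: 'a" 1] order_power_n_n[of "- g" 1] by simp_all
  moreover have "Polynomial.order 0 [:g, 1:] = 0" "Polynomial.order 0 q = 0"
    "Polynomial.order (- g) [:0, 1:] = 0" "Polynomial.order (- g) q = 0"
    "Polynomial.order (- g) (monom 1 k) = 0" for k
    using g q by (auto intro!: order_0I simp: poly_monom)
  ultimately show "n + alg_multiplicity (damped_mat g X Y) 0 = m + 1"
    "alg_multiplicity (damped_mat g X Y) (- g) = 1"
    using order_eq[of 0] order_eq[of "- g"] by (simp_all add: alg_multiplicity_def p_def)
qed

section \<open>Kernel of the block matrix with positive weights\<close>

text \<open>\<open>X\<close> and \<open>Y\<close> are the incidence matrix and its transpose with
  positive row weights, so \<open>weighted_gram_kernel\<close> applies both to \<open>C\<close> and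
  to its transpose. The second fact makes the eigenvalue 0 semisimple; the third shows that the null
  mode of \<open>X * Y\<close> is already killed by \<open>Y\<close>.\<close>

lemma
  fixes C :: "real mat" and g :: complex
  defines "Cc \<equiv> map_mat complex_of_real C"
  assumes C: "C \<in> carrier_mat n m" and g: "g \<noteq> 0"
    and w: "\<And>j. j < n \<Longrightarrow> 0 < w j" and b: "\<And>e. e < m \<Longrightarrow> 0 < b e"
    and X: "X = mat_diag n (\<lambda>j. complex_of_real (w j)) * Cc"
    and Y: "Y = mat_diag m (\<lambda>e. complex_of_real (b e)) * Cc\<^sup>T"
  shows damped_mat_kernel: "\<And>f p. f \<in> carrier_vec n \<Longrightarrow> p \<in> carrier_vec m \<Longrightarrow>
      damped_mat g X Y *\<^sub>v (f @\<^sub>v p) = 0\<^sub>v (n + m) \<longleftrightarrow> f = 0\<^sub>v n \<and> Cc *\<^sub>v p = 0\<^sub>v n"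
    and damped_mat_kernel_square: "\<And>z. z \<in> carrier_vec (n + m) \<Longrightarrow>
      damped_mat g X Y *\<^sub>v (damped_mat g X Y *\<^sub>v z) = 0\<^sub>v (n + m) \<Longrightarrow>
      damped_mat g X Y *\<^sub>v z = 0\<^sub>v (n + m)"
    and damped_mat_product_kernel: "\<And>f. f \<in> carrier_vec n \<Longrightarrow> X *\<^sub>v (Y *\<^sub>v f) = 0\<^sub>v n \<Longrightarrow>
      Y *\<^sub>v f = 0\<^sub>v m"
proof -
  let ?A = "damped_mat g X Y"
  let ?W = "mat_diag n (\<lambda>j. complex_of_real (w j))"
  let ?B = "mat_diag m (\<lambda>e. complex_of_real (b e))"
  have Cc: "Cc \<in> carrier_mat n m" "Cc\<^sup>T \<in> carrier_mat m n"
    using C by (auto simp: Cc_def)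
  have Xc: "X \<in> carrier_mat n m" and Yc: "Y \<in> carrier_mat m n"
    using mult_carrier_mat[OF mat_diag_dim Cc(1)] mult_carrier_mat[OF mat_diag_dim Cc(2)]
    by (simp_all add: X Y)
  have Xv: "X *\<^sub>v p = ?W *\<^sub>v (Cc *\<^sub>v p)" if "p \<in> carrier_vec m" for p
    unfolding X by (rule assoc_mult_mat_vec[OF mat_diag_dim Cc(1) that])
  have Yv: "Y *\<^sub>v f = ?B *\<^sub>v (Cc\<^sup>T *\<^sub>v f)" if "f \<in> carrier_vec n" for f
    unfolding Y by (rule assoc_mult_mat_vec[OF mat_diag_dim Cc(2) that])
  have zero: "K *\<^sub>v 0\<^sub>v c = 0\<^sub>v r" if "K \<in> carrier_mat r c" for K :: "complex mat" and r c
    using that by (rule mult_mat_zero_vec)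
  have g0: "- g \<cdot>\<^sub>v 0\<^sub>v n = 0\<^sub>v n"
    by (intro eq_vecI) auto
  have CY: "Cc\<^sup>T *\<^sub>v f = 0\<^sub>v m" if "f \<in> carrier_vec n" "Cc *\<^sub>v (Y *\<^sub>v f) = 0\<^sub>v n" for f
    using weighted_gram_kernel[OF C that(1), of b] b that Yv[OF that(1)] by (simp add: Cc_def)
  \<comment> \<open>The same Gram argument with nodes and edges exchanged: the transpose of
    \<open>C\<close> takes the place of \<open>R\<close>, and the weights are
    \<open>w\<close>.\<close>
  have CX: "Cc *\<^sub>v p = 0\<^sub>v n" if "p \<in> carrier_vec m" "Cc\<^sup>T *\<^sub>v (X *\<^sub>v p) = 0\<^sub>v m" for p
  proof -
    have "Cc\<^sup>T = map_mat complex_of_real C\<^sup>T" "Cc = (map_mat complex_of_real C\<^sup>T)\<^sup>T"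
      by (auto simp: Cc_def)
    with weighted_gram_kernel[of "C\<^sup>T" m n p w] C w that Xv[OF that(1)] show ?thesis by simp
  qed
  have zz: "f @\<^sub>v p = 0\<^sub>v (n + m) \<longleftrightarrow> f = 0\<^sub>v n \<and> p = 0\<^sub>v m" if "f \<in> carrier_vec n" for f p :: "complex vec"
    unfolding zero_vec_append[symmetric] using that by (rule append_vec_eq) simp
  have split: "?A *\<^sub>v (f @\<^sub>v p) = 0\<^sub>v (n + m) \<longleftrightarrow> - g \<cdot>\<^sub>v f - X *\<^sub>v p = 0\<^sub>v n \<and> Y *\<^sub>v f = 0\<^sub>v m"
    if "f \<in> carrier_vec n" "p \<in> carrier_vec m" for f p
    using that Xc Yc by (simp add: damped_mat_mult_append[OF Xc Yc that] zz)
  show ker: "?A *\<^sub>v (f @\<^sub>v p) = 0\<^sub>v (n + m) \<longleftrightarrow> f = 0\<^sub>v n \<and> Cc *\<^sub>v p = 0\<^sub>v n"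
    if f: "f \<in> carrier_vec n" and p: "p \<in> carrier_vec m" for f p
  proof
    assume "?A *\<^sub>v (f @\<^sub>v p) = 0\<^sub>v (n + m)"
    then have 1: "- g \<cdot>\<^sub>v f - X *\<^sub>v p = 0\<^sub>v n" and 2: "Y *\<^sub>v f = 0\<^sub>v m"
      using split[OF f p] by auto
    have Xp: "X *\<^sub>v p \<in> carrier_vec n" using Xc p by simp
    have Xpf: "X *\<^sub>v p = - g \<cdot>\<^sub>v f"
    proof (rule eq_vecI)
      fix i assume "i < dim_vec (- g \<cdot>\<^sub>v f)"
      then have "i < n" using f by simp
      with arg_cong[OF 1, of "\<lambda>u. u $ i"] f Xp show "(X *\<^sub>v p) $ i = (- g \<cdot>\<^sub>v f) $ i"
        using Xc by (simp add: algebra_simps del: index_mult_mat_vec)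
    qed (use Xc f in simp)
    \<comment> \<open>Since \<open>X *\<^sub>v p\<close> is a multiple of \<open>f\<close>, it
      inherits being annihilated by the transpose of \<open>Cc\<close>. Then \<open>CX\<close> makes
      \<open>Cc *\<^sub>v p\<close> vanish, hence also \<open>X *\<^sub>v p\<close>, and
      \<open>g \<noteq> 0\<close> leaves \<open>f\<close> zero.\<close>
    have "Cc\<^sup>T *\<^sub>v f = 0\<^sub>v m"
      using CY[OF f] 2 zero[OF Cc(1)] by simp
    then have "Cc\<^sup>T *\<^sub>v (X *\<^sub>v p) = 0\<^sub>v m"
      by (simp add: Xpf mult_mat_vec[OF Cc(2) f]) auto
    then have Cp: "Cc *\<^sub>v p = 0\<^sub>v n" by (rule CX[OF p])
    then have gf: "- g \<cdot>\<^sub>v f = 0\<^sub>v n"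
      using Xpf Xv[OF p] zero[OF mat_diag_dim] by simp
    have "f $ i = 0" if "i < n" for i
      using arg_cong[OF gf, of "\<lambda>u. u $ i"] that f g by simp
    then have "f = 0\<^sub>v n" using f by (intro eq_vecI) auto
    with Cp show "f = 0\<^sub>v n \<and> Cc *\<^sub>v p = 0\<^sub>v n" by simp
  next
    assume "f = 0\<^sub>v n \<and> Cc *\<^sub>v p = 0\<^sub>v n"
    then show "?A *\<^sub>v (f @\<^sub>v p) = 0\<^sub>v (n + m)"
      using split[OF f p] Xv[OF p] zero[OF mat_diag_dim] zero[OF Yc] g0 by simp
  qed
  have Y0: "Y *\<^sub>v f = 0\<^sub>v m" if "f \<in> carrier_vec n" "Cc *\<^sub>v (Y *\<^sub>v f) = 0\<^sub>v n" for f
    using CY[OF that] Yv[OF that(1)] zero[OF mat_diag_dim] by simp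
  show "Y *\<^sub>v f = 0\<^sub>v m" if f: "f \<in> carrier_vec n" and XY: "X *\<^sub>v (Y *\<^sub>v f) = 0\<^sub>v n" for f
  proof -
    have Yf: "Y *\<^sub>v f \<in> carrier_vec m" using Yc f by simp
    \<comment> \<open>Placing \<open>Y *\<^sub>v f\<close> in the lower block gives a kernel vector,
      so the weights of \<open>X\<close> can be stripped off and \<open>Y0\<close> applies.\<close>
    have "?A *\<^sub>v (0\<^sub>v n @\<^sub>v (Y *\<^sub>v f)) = 0\<^sub>v (n + m)"
      using split[OF zero_carrier_vec Yf] XY zero[OF Yc] g0 by simp
    then show ?thesis
      using ker[OF zero_carrier_vec Yf] Y0[OF f] by simp
  qed
  fix z :: "complex vec"
  assume z: "z \<in> carrier_vec (n + m)" and zero2: "?A *\<^sub>v (?A *\<^sub>v z) = 0\<^sub>v (n + m)"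
  obtain f p where fp: "f \<in> carrier_vec n" "p \<in> carrier_vec m" "z = f @\<^sub>v p"
    using z vec_first_last_append by (metis vec_first_carrier vec_last_carrier)
  have Yf: "Y *\<^sub>v f \<in> carrier_vec m" using Yc fp by simp
  have h: "- g \<cdot>\<^sub>v f - X *\<^sub>v p \<in> carrier_vec n" using Xc fp by simp
  have Az: "?A *\<^sub>v z = (- g \<cdot>\<^sub>v f - X *\<^sub>v p) @\<^sub>v (Y *\<^sub>v f)"
    unfolding fp(3) by (rule damped_mat_mult_append[OF Xc Yc fp(1,2)])
  \<comment> \<open>The vector \<open>?A *\<^sub>v z\<close> lies in the kernel, so its upper block
    is zero. Its lower block lies in the range of \<open>Y\<close> and in the kernel of
    \<open>Cc\<close>, and \<open>Y0\<close> says that these meet only in zero.\<close>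
  then have h0: "- g \<cdot>\<^sub>v f - X *\<^sub>v p = 0\<^sub>v n" and "Cc *\<^sub>v (Y *\<^sub>v f) = 0\<^sub>v n"
    using zero2 ker[OF h Yf] by simp_all
  with Y0[OF fp(1)] Az show "?A *\<^sub>v z = 0\<^sub>v (n + m)" by (simp add: zero_vec_append)
qed

theorem mainTheorem1:
  fixes n m :: nat
    and G :: "(nat, nat) pre_digraph"
    and M B C D L A :: "real mat"
    and \<gamma> :: real
    and lam :: "nat \<Rightarrow> real"
    and v :: "nat \<Rightarrow> real vec"
  assumes graph: "oriented_simple_graph G" "Digraph_Component.connected G"
    and nodes: "verts G = {0..<n}"
    and edges: "arcs G = {0..<m}"
    and C: "C = incidence_mat n m G"
    and M: "M \<in> carrier_mat n n" "diagonal_mat M" "\<forall>j<n. 0 < M $$ (j, j)"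
    and B: "B \<in> carrier_mat m m" "diagonal_mat B" "\<forall>e<m. 0 < B $$ (e, e)"
    and \<gamma>: "0 < \<gamma>"
    and D: "D = \<gamma> \<cdot>\<^sub>m M"
    and L: "L = diag_powr M (- 1 / 2) * C * B * C\<^sup>T * diag_powr M (- 1 / 2)"
    and lam: "lam 1 = 0" "2 \<le> n \<longrightarrow> lam 1 < lam 2" "\<forall>i\<in>{2..<n}. lam i \<le> lam (i + 1)"
    and eigvecs: "\<forall>i\<in>{1..n}. eigenvector L (v i) (lam i)"
    and orthonormal: "\<forall>i\<in>{1..n}. \<forall>j\<in>{1..n}. v i \<bullet> v j = (if i = j then 1 else 0)"
    and A: "A = four_block_mat
                  (- (diag_powr M (- 1) * D)) (- (diag_powr M (- 1) * C))
                  (B * C\<^sup>T)                    (0\<^sub>m m m)"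
  shows "let A\<^sub>c = map_mat complex_of_real A; C\<^sub>c = map_mat complex_of_real C in
      (int (alg_multiplicity A\<^sub>c 0) = int m - int n + 1
       \<and> int (geom_multiplicity A\<^sub>c 0) = int m - int n + 1
       \<and> (eigenvalue A\<^sub>c 0 \<longleftrightarrow> int m - int n + 1 \<noteq> 0)
       \<and> (\<forall>w. eigenvector A\<^sub>c w 0 \<longleftrightarrow>
             w \<noteq> 0\<^sub>v (n + m) \<and> (\<exists>P \<in> mat_kernel C\<^sub>c. w = 0\<^sub>v n @\<^sub>v P)))
    \<and> (alg_multiplicity A\<^sub>c (complex_of_real (- \<gamma>)) = 1
       \<and> eigenvector A\<^sub>c
           (map_vec complex_of_real ((diag_powr M (- 1 / 2) *\<^sub>v v 1) @\<^sub>v 0\<^sub>v m))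
           (complex_of_real (- \<gamma>)))
    \<and> (\<forall>i\<in>{2..n}. \<forall>s\<in>{1, - 1}.
         let \<phi> = (- complex_of_real \<gamma> + s * csqrt (complex_of_real (\<gamma>\<^sup>2 - 4 * lam i))) / 2 in
           eigenvalue A\<^sub>c \<phi>
         \<and> eigenvector A\<^sub>c
             (map_vec complex_of_real (diag_powr M (- 1 / 2) *\<^sub>v v i)
              @\<^sub>v (inverse \<phi> \<cdot>\<^sub>v
                    map_vec complex_of_real (B * C\<^sup>T * diag_powr M (- 1 / 2) *\<^sub>v v i)))
             \<phi>)"
proof -

  \<comment> \<open>Similarity between the product of the off-diagonal blocks and the
    Laplacian\<close>
  define R W S where "R = diag_powr M (- 1 / 2)"
    and "W = diag_powr M (- 1)" and "S = diag_powr M (1 / 2)"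
  define X Y where "X = W * C" and "Y = B * C\<^sup>T"
  have carr: "R \<in> carrier_mat n n" "W \<in> carrier_mat n n" "S \<in> carrier_mat n n"
    "C \<in> carrier_mat n m" "C\<^sup>T \<in> carrier_mat m n" "B \<in> carrier_mat m m"
    using M(1) B(1) by (auto simp: R_def W_def S_def C incidence_mat_def)
  have X_carrier: "X \<in> carrier_mat n m" and Y_carrier: "Y \<in> carrier_mat m n"
    unfolding X_def Y_def by (rule mult_carrier_mat; rule carr)+
  have Lc: "L \<in> carrier_mat n n"
    unfolding L R_def[symmetric] by (intro mult_carrier_mat) (rule carr)+
  have RS: "R * S = 1\<^sub>m n" "S * R = 1\<^sub>m n" and RR: "R * R = W"
    using diag_powr_zero[OF M(1,3)]
    by (simp_all add: R_def S_def W_def diag_powr_mult)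

  \<comment> \<open>Connectedness includes having at least one vertex, so the index 1
    exists.\<close>
  have "n \<noteq> 0"
    using graph(2) nodes by (auto simp: Digraph_Component.connected_def strongly_connected_def)
  then have n: "0 < n" by simp
  have lam_pos: "0 < lam i" if "2 \<le> i" "i \<le> n" for i
    using that
  proof (induction i rule: dec_induct)
    case base
    then show ?case using lam(1,2) by simp
  next
    case (step i)
    then show ?case using lam(3) by (force intro: less_le_trans)
  qed

  have vc: "v i \<in> carrier_vec n" and v0: "v i \<noteq> 0\<^sub>v n" and Lv: "L *\<^sub>v v i = lam i \<cdot>\<^sub>v v i"
    if "i \<in> {1..n}" for i
    using eigvecs that Lc by (auto simp: eigenvector_def)
  \<comment> \<open>In \<open>R * L * S\<close> the last factor of \<open>L\<close> cancels against
    \<open>S\<close>, while its first factor merges with \<open>R\<close> into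
    \<open>W\<close>.\<close>
  have XY: "X * Y = R * L * S"
  proof -
    have assoc: "R * (R * N * R) * S = R * R * N * (R * S)"
      if "R \<in> carrier_mat n n" "N \<in> carrier_mat n n" "S \<in> carrier_mat n n" for R N S :: "real mat"
      using that by (simp add: assoc_mult_mat[of _ n n _ n _ n])
    have N: "C * Y \<in> carrier_mat n n" by (intro mult_carrier_mat) (rule carr Y_carrier)+
    have RC: "R * C \<in> carrier_mat n m" by (intro mult_carrier_mat) (rule carr)+
    have "R * C * B * C\<^sup>T = R * (C * Y)"
      unfolding assoc_mult_mat[OF RC carr(6,5)] Y_def[symmetric]
      by (rule assoc_mult_mat[OF carr(1,4) Y_carrier])
    then have "L = R * (C * Y) * R"
      by (simp only: L R_def[symmetric])
    then have "R * L * S = (R * R) * (C * Y) * (R * S)"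
      using assoc[OF carr(1) N carr(3)] by simp
    also have "\<dots> = W * (C * Y)"
      unfolding RR RS by (rule right_mult_one_mat[OF mult_carrier_mat[OF carr(2) N]])
    also have "\<dots> = X * Y"
      unfolding X_def by (rule assoc_mult_mat[OF carr(2,4) Y_carrier, symmetric])
    finally show ?thesis by simp
  qed
  \<comment> \<open>Since \<open>R\<close> conjugates \<open>L\<close> to \<open>X * Y\<close>, it
    carries eigenvectors of \<open>L\<close> to eigenvectors of \<open>X * Y\<close>.\<close>
  define f where "f i = R *\<^sub>v v i" for i
  have f: "f i \<in> carrier_vec n" "f i \<noteq> 0\<^sub>v n" "X *\<^sub>v (Y *\<^sub>v f i) = lam i \<cdot>\<^sub>v f i"
    if i: "i \<in> {1..n}" for i
  proof -
    show fc: "f i \<in> carrier_vec n" using vc[OF i] carr by (simp add: f_def)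
    have Sf: "S *\<^sub>v f i = v i"
      using vc[OF i] assoc_mult_mat_vec[OF carr(3,1), of "v i"] by (simp add: f_def RS)
    show "f i \<noteq> 0\<^sub>v n"
    proof
      assume "f i = 0\<^sub>v n"
      then have "v i = 0\<^sub>v n" using Sf mult_mat_zero_vec[OF carr(3)] by simp
      with v0[OF i] show False ..
    qed
    have "X *\<^sub>v (Y *\<^sub>v f i) = (R * L * S) *\<^sub>v f i"
      using assoc_mult_mat_vec[OF X_carrier Y_carrier fc] by (simp add: XY)
    also have "\<dots> = R *\<^sub>v (L *\<^sub>v (S *\<^sub>v f i))"
      using fc Lc carr by (simp add: assoc_mult_mat_vec[of _ n n _ n] mult_carrier_mat[of _ n n _ n])
    also have "\<dots> = lam i \<cdot>\<^sub>v f i"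
      by (simp only: Sf Lv[OF i] mult_mat_vec[OF carr(1) vc[OF i]]) (simp only: f_def)
    finally show "X *\<^sub>v (Y *\<^sub>v f i) = lam i \<cdot>\<^sub>v f i" .
  qed

  \<comment> \<open>Products run from 0 while the eigenvalues are numbered from 1, hence the
    \<open>Suc\<close>.\<close>
  have "char_poly L = (\<Prod>i<n. [:- lam (Suc i), 1:])"
    using eigvecs orthonormal
    by (intro char_poly_orthonormal_eigenbasis[OF Lc, where v = "\<lambda>i. v (Suc i)"]) auto
  moreover have "similar_mat (X * Y) L"
    using Lc RS XY carr X_carrier Y_carrier by (intro similar_matI[of _ _ R S n]) auto
  ultimately have chi: "char_poly (X * Y) = (\<Prod>i<n. [:- lam (Suc i), 1:])"
    by (simp add: char_poly_similar)

  \<comment> \<open>Complexification and algebraic multiplicities\<close>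
  define Ac Cc Xc Yc where "Ac = map_mat complex_of_real A" and "Cc = map_mat complex_of_real C"
    and "Xc = map_mat complex_of_real X" and "Yc = map_mat complex_of_real Y"
  define g where "g = complex_of_real \<gamma>"
  have g: "g \<noteq> 0" using \<gamma> by (simp add: g_def)
  have Xcc: "Xc \<in> carrier_mat n m" and Ycc: "Yc \<in> carrier_mat m n"
    and Ccc: "Cc \<in> carrier_mat n m"
    using X_carrier Y_carrier carr by (simp_all add: Xc_def Yc_def Cc_def)
  have "A = damped_mat \<gamma> X Y"
  proof -
    \<comment> \<open>Proportional damping makes the upper left block a scalar matrix.\<close>
    have "W * (\<gamma> \<cdot>\<^sub>m M) = \<gamma> \<cdot>\<^sub>m 1\<^sub>m n"
      using mult_smult_distrib[OF carr(2) M(1), of \<gamma>] by (simp only: W_def diag_powr_inverse(2)[OF M])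
    moreover have "- (\<gamma> \<cdot>\<^sub>m 1\<^sub>m n) = - \<gamma> \<cdot>\<^sub>m 1\<^sub>m n" by (intro eq_matI) auto
    ultimately show ?thesis
      using X_carrier by (simp add: A D damped_mat_def flip: W_def X_def Y_def)
  qed
  then have Ac: "Ac = damped_mat g Xc Yc"
    by (simp add: Ac_def g_def Xc_def Yc_def map_damped_mat[OF X_carrier Y_carrier])
  have Acc: "Ac \<in> carrier_mat (n + m) (n + m)" by (simp add: Ac Xcc)
  have chic: "char_poly (Xc * Yc) = (\<Prod>i<n. [:- complex_of_real (lam (Suc i)), 1:])"
  proof -
    interpret map_poly_of_real: map_poly_comm_ring_hom complex_of_real ..
    have "Xc * Yc = map_mat complex_of_real (X * Y)"
      by (simp add: Xc_def Yc_def of_real_hom.mat_hom_mult[OF X_carrier Y_carrier])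
    then have "char_poly (Xc * Yc) = map_poly complex_of_real (char_poly (X * Y))"
      by (simp add: of_real_hom.char_poly_hom[OF mult_carrier_mat[OF X_carrier Y_carrier]])
    then show ?thesis
      by (simp add: chi map_poly_of_real.hom_prod of_real_hom.map_poly_pCons_hom)
  qed
  have alg: "n + alg_multiplicity Ac 0 = m + 1" "alg_multiplicity Ac (- g) = 1"
  proof -
    have l0: "complex_of_real (lam (Suc 0)) = 0" using lam(1) by simp
    have l_pos: "complex_of_real (lam (Suc i)) \<noteq> 0" if "0 < i" "i < n" for i
      using lam_pos[of "Suc i"] that by simp
    show "n + alg_multiplicity Ac 0 = m + 1" "alg_multiplicity Ac (- g) = 1"
      unfolding Ac by (rule alg_multiplicity_damped_mat[OF Xcc Ycc chic n l0 l_pos g]; assumption)+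
  qed

  \<comment> \<open>The eigenvalue 0 and its eigenvectors\<close>
  have XcW: "Xc = mat_diag n (\<lambda>j. complex_of_real (M $$ (j, j) powr - 1)) * Cc"
  proof -
    have "map_mat complex_of_real W = mat_diag n (\<lambda>j. complex_of_real (M $$ (j, j) powr - 1))"
      using M(1) by (intro eq_matI) (auto simp: W_def diag_powr_def mat_diag_def)
    then show ?thesis
      by (simp add: Xc_def X_def Cc_def of_real_hom.mat_hom_mult[OF carr(2,4)])
  qed
  have YcB: "Yc = mat_diag m (\<lambda>e. complex_of_real (B $$ (e, e))) * Cc\<^sup>T"
  proof -
    have "map_mat complex_of_real B = mat_diag m (\<lambda>e. complex_of_real (B $$ (e, e)))"
      using B by (intro eq_matI) (auto simp: mat_diag_def diagonal_mat_def)
    then show ?thesis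
      by (simp add: Yc_def Y_def Cc_def of_real_hom.mat_hom_mult[OF carr(6,5)] map_mat_transpose)
  qed
  have w: "0 < M $$ (j, j) powr - 1" if "j < n" for j
    using M(3) that by force
  have b: "0 < B $$ (e, e)" if "e < m" for e
    using B(3) that by simp
  note kernel_facts = carr(4) g w b XcW[unfolded Cc_def] YcB[unfolded Cc_def]
  have ker: "Ac *\<^sub>v (h @\<^sub>v p) = 0\<^sub>v (n + m) \<longleftrightarrow> h = 0\<^sub>v n \<and> Cc *\<^sub>v p = 0\<^sub>v n"
    if "h \<in> carrier_vec n" "p \<in> carrier_vec m" for h p
    unfolding Ac Cc_def by (rule damped_mat_kernel[OF kernel_facts that])
  have ker_square: "Ac *\<^sub>v z = 0\<^sub>v (n + m)"
    if "z \<in> carrier_vec (n + m)" "Ac *\<^sub>v (Ac *\<^sub>v z) = 0\<^sub>v (n + m)" for z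
    unfolding Ac by (rule damped_mat_kernel_square[OF kernel_facts that[unfolded Ac]])

  have char_matrix_0: "char_matrix Ac 0 = Ac"
    using Acc by (intro eq_matI) (auto simp: char_matrix_def)
  have geom: "geom_multiplicity Ac 0 = alg_multiplicity Ac 0"
    by (rule geom_eq_alg_multiplicity[OF Acc]) (unfold char_matrix_0, rule ker_square)
  \<comment> \<open>A root corresponds to positive order only for a nonzero polynomial.\<close>
  have "char_poly Ac \<noteq> 0"
    using degree_monic_char_poly[OF Acc] by auto
  then have ev0: "eigenvalue Ac 0 \<longleftrightarrow> alg_multiplicity Ac 0 \<noteq> 0"
    by (simp add: eigenvalue_root_char_poly[OF Acc] order_root alg_multiplicity_def)
  have eigvec0: "eigenvector Ac u 0 \<longleftrightarrow>
      u \<noteq> 0\<^sub>v (n + m) \<and> (\<exists>P \<in> mat_kernel Cc. u = 0\<^sub>v n @\<^sub>v P)" for u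
  proof -
    have "u \<in> carrier_vec (n + m) \<and> Ac *\<^sub>v u = 0 \<cdot>\<^sub>v u \<longleftrightarrow> (\<exists>P \<in> mat_kernel Cc. u = 0\<^sub>v n @\<^sub>v P)"
    proof
      assume u: "u \<in> carrier_vec (n + m) \<and> Ac *\<^sub>v u = 0 \<cdot>\<^sub>v u"
      then obtain h p where hp: "h \<in> carrier_vec n" "p \<in> carrier_vec m" "u = h @\<^sub>v p"
        by (metis vec_first_last_append vec_first_carrier vec_last_carrier)
      have "0 \<cdot>\<^sub>v u = 0\<^sub>v (n + m)" using u by (intro eq_vecI) auto
      with u hp show "\<exists>P \<in> mat_kernel Cc. u = 0\<^sub>v n @\<^sub>v P"
        using ker[OF hp(1,2)] by (auto simp: mat_kernel[OF Ccc])
    next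
      assume "\<exists>P \<in> mat_kernel Cc. u = 0\<^sub>v n @\<^sub>v P"
      then obtain P where P: "P \<in> carrier_vec m" "Cc *\<^sub>v P = 0\<^sub>v n" "u = 0\<^sub>v n @\<^sub>v P"
        by (auto simp: mat_kernel[OF Ccc])
      then have u: "u \<in> carrier_vec (n + m)" by simp
      moreover have "0 \<cdot>\<^sub>v u = 0\<^sub>v (n + m)" using u by (intro eq_vecI) auto
      ultimately show "u \<in> carrier_vec (n + m) \<and> Ac *\<^sub>v u = 0 \<cdot>\<^sub>v u"
        using ker[of "0\<^sub>v n" P] P by simp
    qed
    then show ?thesis
      using Acc by (auto simp: eigenvector_def)
  qed

  \<comment> \<open>Eigenvectors for the remaining eigenvalues\<close>
  define fc where "fc i = map_vec complex_of_real (f i)" for i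
  have Ycf: "Yc *\<^sub>v fc i = map_vec complex_of_real (Y *\<^sub>v f i)" if "i \<in> {1..n}" for i
    by (simp add: Yc_def fc_def of_real_hom.mult_mat_vec_hom[OF Y_carrier f(1)[OF that]])
  have fc: "fc i \<in> carrier_vec n" "fc i \<noteq> 0\<^sub>v n"
    "Xc *\<^sub>v (Yc *\<^sub>v fc i) = complex_of_real (lam i) \<cdot>\<^sub>v fc i" if i: "i \<in> {1..n}" for i
  proof -
    show "fc i \<in> carrier_vec n" "fc i \<noteq> 0\<^sub>v n"
      using f(1,2)[OF i] by (auto simp: fc_def)
    have "Y *\<^sub>v f i \<in> carrier_vec m" using Y_carrier f(1)[OF i] by simp
    then have "Xc *\<^sub>v (Yc *\<^sub>v fc i) = map_vec complex_of_real (X *\<^sub>v (Y *\<^sub>v f i))"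
      unfolding Ycf[OF i] Xc_def by (simp add: of_real_hom.mult_mat_vec_hom[OF X_carrier])
    then show "Xc *\<^sub>v (Yc *\<^sub>v fc i) = complex_of_real (lam i) \<cdot>\<^sub>v fc i"
      using f(3)[OF i] by (simp add: fc_def of_real_hom.vec_hom_smult)
  qed

  have decay: "eigenvector Ac (map_vec complex_of_real (f 1 @\<^sub>v 0\<^sub>v m)) (- g)"
  proof -
    have i: "1 \<in> {1..n}" using n by simp
    have fp: "fc 1 \<in> carrier_vec n" "Yc *\<^sub>v fc 1 \<in> carrier_vec m"
      using fc(1)[OF i] Ycc by simp_all
    have XYf: "Xc *\<^sub>v (Yc *\<^sub>v fc 1) = 0\<^sub>v n"
      using fc(1,3)[OF i] lam(1) by (auto intro!: eq_vecI)
    \<comment> \<open>As \<open>lam 1 = 0\<close>, the vector \<open>fc 1\<close> is in the kernel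
      of \<open>Xc * Yc\<close>, and hence in that of \<open>Yc\<close>.\<close>
    have "Yc *\<^sub>v fc 1 = 0\<^sub>v m"
      by (rule damped_mat_product_kernel[OF kernel_facts fp(1) XYf])
    then have "eigenvector Ac (fc 1 @\<^sub>v 0\<^sub>v m) (- g)"
      unfolding Ac by (intro damped_mat_eigenvector_decay[OF Xcc Ycc fc(1,2)[OF i]])
    moreover have "map_vec complex_of_real (f 1 @\<^sub>v 0\<^sub>v m) = fc 1 @\<^sub>v 0\<^sub>v m"
      by (intro eq_vecI) (auto simp: fc_def)
    ultimately show ?thesis by simp
  qed
  have modes: "eigenvector Ac (fc i @\<^sub>v (inverse x \<cdot>\<^sub>v (Yc *\<^sub>v fc i))) x"
    if i: "i \<in> {2..n}" and s: "s \<in> {1, - 1}"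
      and x: "x = (- g + s * csqrt (complex_of_real (\<gamma>\<^sup>2 - 4 * lam i))) / 2" for i s x
  proof -
    have i': "i \<in> {1..n}" using i by simp
    have s2: "s * s = 1" using s by auto
    \<comment> \<open>Only the squares of \<open>s\<close> and of the root enter, so both signs and
      negative discriminants are handled at once.\<close>
    have "x * (x + g) = (s * s * (csqrt (complex_of_real (\<gamma>\<^sup>2 - 4 * lam i)))\<^sup>2 - g\<^sup>2) / 4"
      by (simp add: x field_simps power2_eq_square)
    also have "\<dots> = - complex_of_real (lam i)"
      by (simp add: s2 g_def)
    finally have x': "x * (x + g) = - complex_of_real (lam i)" .
    \<comment> \<open>If \<open>x\<close> were zero, then so would be \<open>lam i\<close>, against
      its positivity for \<open>i\<close> at least 2.\<close>
    moreover have "x \<noteq> 0" using x' lam_pos[of i] i by auto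
    ultimately show ?thesis
      unfolding Ac by (intro damped_mat_eigenvector[OF Xcc Ycc fc[OF i']])
  qed
  have BCR: "B * C\<^sup>T * R *\<^sub>v v i = Y *\<^sub>v f i" if "i \<in> {1..n}" for i
    using vc[OF that] assoc_mult_mat_vec[OF Y_carrier carr(1), of "v i"] by (simp add: Y_def f_def)
  show ?thesis
    unfolding Let_def Ac_def[symmetric] Cc_def[symmetric] R_def[symmetric] f_def[symmetric]
  proof (intro conjI ballI allI)
    fix i s assume i_s: "i \<in> {2..n}" "s \<in> {1, - 1 :: complex}"
    let ?x = "(- complex_of_real \<gamma> + s * csqrt (complex_of_real (\<gamma>\<^sup>2 - 4 * lam i))) / 2"
    have "i \<in> {1..n}" using i_s by simp
    then have Yf: "map_vec complex_of_real (B * C\<^sup>T * R *\<^sub>v v i) = Yc *\<^sub>v map_vec complex_of_real (f i)"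
      by (simp only: BCR Ycf[unfolded fc_def])
    have "eigenvector Ac (map_vec complex_of_real (f i) @\<^sub>v (inverse ?x \<cdot>\<^sub>v
        map_vec complex_of_real (B * C\<^sup>T * R *\<^sub>v v i))) ?x"
      using modes[OF i_s refl] by (simp only: g_def fc_def Yf)
    then show "eigenvalue Ac ?x" "eigenvector Ac (map_vec complex_of_real (f i) @\<^sub>v (inverse ?x \<cdot>\<^sub>v
        map_vec complex_of_real (B * C\<^sup>T * R *\<^sub>v v i))) ?x"
      unfolding eigenvalue_def by blast+
  next
    \<comment> \<open>The additive identity over the naturals also forces
      \<open>n \<le> m + 1\<close>, so the integer value is never negative and is 0 exactly when
      \<open>m + 1 = n\<close>.\<close>
    show "int (alg_multiplicity Ac 0) = int m - int n + 1" using alg(1) by linarith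
    then show "int (geom_multiplicity Ac 0) = int m - int n + 1"
      unfolding geom .
    show "eigenvalue Ac 0 \<longleftrightarrow> int m - int n + 1 \<noteq> 0"
      unfolding ev0 using alg(1) by linarith
    show "eigenvector Ac u 0 \<longleftrightarrow> u \<noteq> 0\<^sub>v (n + m) \<and> (\<exists>P \<in> mat_kernel Cc. u = 0\<^sub>v n @\<^sub>v P)" for u
      by (rule eigvec0)
    show "alg_multiplicity Ac (complex_of_real (- \<gamma>)) = 1"
      using alg(2) by (simp add: g_def)
    show "eigenvector Ac (map_vec complex_of_real (f 1 @\<^sub>v 0\<^sub>v m)) (complex_of_real (- \<gamma>))"
      using decay by (simp only: g_def of_real_minus)
  qed
qed

end
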